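(* Let $\Gamma$ be a finitely generated, infinite group and let $\mathcal G$ be the Cayley graph of $\Gamma$ with respect to a finite symmetric generating set. Suppose that $\Gamma$ has an invariant action on a space with measured walls $(X,\mathcal W,\mathcal B,\mu)$ and fix $x_0\in X$. For $p\in(0,1)$ define $$\alpha_p:=\exp\Bigl(-(1-p)\max_{h\sim o}w(x_0,hx_0)\Bigr).$$ Then there exists a $\Gamma$-invariant bond percolation $\mathbb P$ on $\mathcal G$ such that $\mathbb E[\deg_\omega(o)]\ge\alpha_p\deg(o)$ and $$\exp\Bigl(-(1-p)\max_{h\sim o}w(x_0,hx_0)\,|g|\Bigr)\le\tau(o,g)\le\exp\bigl(-(1-p)\,w(x_0,gx_0)\bigr)\qquad\text{for every } g\in\Gamma.$$
   Context: Right Cayley graph: vertex set $\Gamma$, edge set $E=\{[g,gs]: g\in\Gamma, s\in S\}$ with $S$ a finite symmetric generating set; $o$ is the identity, $h\sim o$ means $h$ is a neighbor of $o$, $|g|$ is the graph distance from $o$ to $g$, $\deg(o)$ the degree of $o$. $\Gamma$ acts by left multiplication. A $\Gamma$-invariant bond percolation is a probability measure $\mathbb P$ (expectation $\mathbb E$) on subsets $\omega\subset E$ invariant under $\Gamma$; clusters are connected components of $(\Gamma,\omega)$; $\deg_\omega(o)$ is the degree of $o$ in $\omega$; $\tau(g,h)=\mathbb P[g\leftrightarrow h]$ is the probability that $g,h$ are in the same cluster. A wall on a set $X$ is a partition of $X$ into two classes; it separates $x,y\in X$ if they lie in different classes. A space with measured walls is a 4-tuple $(X,\mathcal W,\mathcal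 B,\mu)$ with $\mathcal W$ a set of walls on $X$, $\mathcal B$ a $\sigma$-algebra on $\mathcal W$, $\mu$ a measure on $\mathcal B$, such that for all distinct $x,y\in X$ the set $\mathcal W(x,y)$ of walls in $\mathcal W$ separating $x$ and $y$ is in $\mathcal B$ and $w(x,y):=\mu(\mathcal W(x,y))<\infty$ (and $w(x,x)=0$). $\Gamma$ has an invariant action on it if $\Gamma$ acts on $X$ and the maps $\{B,B^c\}\mapsto\{gB,gB^c\}$ define a $\mathcal B$-measurable action of $\Gamma$ on $\mathcal W$ preserving $\mu$. *)

theory Defs
  imports "HOL-Probability.Probability" "HOL-Algebra.Generated_Groups" "HOL-Algebra.Group_Action"
begin

definition symmetric_generating_set :: "('a, 'c) monoid_scheme \<Rightarrow> 'a set \<Rightarrow> bool" where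
  "symmetric_generating_set G S \<longleftrightarrow>
     S \<subseteq> carrier G \<and> (\<forall>s\<in>S. inv\<^bsub>G\<^esub> s \<in> S) \<and> generate G S = carrier G"

text \<open>Edges are unordered pairs, represented as sets of endpoints. The identity is not excluded
  from \<open>S\<close>; if it belongs to \<open>S\<close>, every vertex carries a loop, represented by a singleton.\<close>

definition cayley_edges :: "('a, 'c) monoid_scheme \<Rightarrow> 'a set \<Rightarrow> 'a set set" where
  "cayley_edges G S = {{g, g \<otimes>\<^bsub>G\<^esub> s} | g s. g \<in> carrier G \<and> s \<in> S}"

definition adjacency :: "'a set set \<Rightarrow> ('a \<times> 'a) set" where
  "adjacency \<omega> = {(x, y). {x, y} \<in> \<omega>}"

definition neighbours :: "'a set set \<Rightarrow> 'a \<Rightarrow> 'a set" where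
  "neighbours \<omega> x = {y. (x, y) \<in> adjacency \<omega>}"

definition vertex_degree :: "'a set set \<Rightarrow> 'a \<Rightarrow> nat" where
  "vertex_degree \<omega> x = card {e \<in> \<omega>. x \<in> e}"

definition graph_dist :: "'a set set \<Rightarrow> 'a \<Rightarrow> 'a \<Rightarrow> nat" where
  "graph_dist \<omega> x y = (LEAST n. (x, y) \<in> adjacency \<omega> ^^ n)"

definition word_length :: "('a, 'c) monoid_scheme \<Rightarrow> 'a set \<Rightarrow> 'a \<Rightarrow> nat" where
  "word_length G S g = graph_dist (cayley_edges G S) \<one>\<^bsub>G\<^esub> g"

definition cluster :: "'a set set \<Rightarrow> 'a \<Rightarrow> 'a set" where
  "cluster \<omega> x = (adjacency \<omega>)\<^sup>* `` {x}"

definition measure_preserving :: "'a measure \<Rightarrow> ('a \<Rightarrow> 'a) \<Rightarrow> bool" where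
  "measure_preserving M f \<longleftrightarrow> f \<in> measurable M M \<and> distr M M f = M"

text \<open>The subsets of \<open>E\<close> with the product \<open>\<sigma>\<close>-algebra, generated by the
  events that a given edge is open; only the measurable structure of this measure is used.\<close>

definition configurations :: "'a set set \<Rightarrow> 'a set set measure" where
  "configurations E = sigma (Pow E) {{\<omega> \<in> Pow E. e \<in> \<omega>} | e. e \<in> E}"

definition translate :: "('a, 'c) monoid_scheme \<Rightarrow> 'a \<Rightarrow> 'a set set \<Rightarrow> 'a set set" where
  "translate G g \<omega> = (\<lambda>e. (\<lambda>x. g \<otimes>\<^bsub>G\<^esub> x) ` e) ` \<omega>"

definition invariant_bond_percolation ::
    "('a, 'c) monoid_scheme \<Rightarrow> 'a set \<Rightarrow> 'a set set measure \<Rightarrow> bool" where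
  "invariant_bond_percolation G S P \<longleftrightarrow>
     prob_space P \<and> sets P = sets (configurations (cayley_edges G S)) \<and>
     (\<forall>g\<in>carrier G. measure_preserving P (translate G g))"

definition two_point :: "'a set set measure \<Rightarrow> 'a \<Rightarrow> 'a \<Rightarrow> real" where
  "two_point P g h = measure P {\<omega> \<in> space P. h \<in> cluster \<omega> g}"

definition wall :: "'b set \<Rightarrow> 'b set set \<Rightarrow> bool" where
  "wall X W \<longleftrightarrow> partition_on X W \<and> card W = 2"

definition separates :: "'b set set \<Rightarrow> 'b \<Rightarrow> 'b \<Rightarrow> bool" where
  "separates W x y \<longleftrightarrow> (\<exists>A\<in>W. \<exists>B\<in>W. A \<noteq> B \<and> x \<in> A \<and> y \<in> B)"

text \<open>The triple of a set of walls, a \<open>\<sigma>\<close>-algebra on it and a measure is bundled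
  into a single \<open>M\<close>.\<close>

definition separating_walls :: "'b set set measure \<Rightarrow> 'b \<Rightarrow> 'b \<Rightarrow> 'b set set set" where
  "separating_walls M x y = {W \<in> space M. separates W x y}"

definition measured_walls_space :: "'b set \<Rightarrow> 'b set set measure \<Rightarrow> bool" where
  "measured_walls_space X M \<longleftrightarrow>
     (\<forall>W\<in>space M. wall X W) \<and>
     (\<forall>x\<in>X. \<forall>y\<in>X. x \<noteq> y \<longrightarrow>
        separating_walls M x y \<in> sets M \<and> emeasure M (separating_walls M x y) < \<infinity>)"

definition wall_dist :: "'b set set measure \<Rightarrow> 'b \<Rightarrow> 'b \<Rightarrow> real" where
  "wall_dist M x y = measure M (separating_walls M x y)"

text \<open>Measurability of the maps below includes that they send walls of \<open>M\<close> to walls of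
  \<open>M\<close>; that they form an action then follows from \<open>\<phi>\<close> being an action.\<close>

definition invariant_walls_action ::
    "('a, 'c) monoid_scheme \<Rightarrow> 'b set \<Rightarrow> 'b set set measure \<Rightarrow> ('a \<Rightarrow> 'b \<Rightarrow> 'b) \<Rightarrow> bool" where
  "invariant_walls_action G X M \<phi> \<longleftrightarrow>
     group_action G X \<phi> \<and>
     (\<forall>g\<in>carrier G. measure_preserving M (\<lambda>W. (\<lambda>B. \<phi> g ` B) ` W))"

definition max_displacement ::
    "('a, 'c) monoid_scheme \<Rightarrow> 'a set \<Rightarrow> 'b set set measure \<Rightarrow> ('a \<Rightarrow> 'b \<Rightarrow> 'b) \<Rightarrow> 'b \<Rightarrow> real" where
  "max_displacement G S M \<phi> x0 =
     Max ((\<lambda>h. wall_dist M x0 (\<phi> h x0)) ` neighbours (cayley_edges G S) \<one>\<^bsub>G\<^esub>)"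

end

theory Submission
  imports Defs
begin

text \<open>The percolation is driven by a Poisson process of walls of intensity \<open>(1 - p) \<mu>\<close>: the
  edge \<open>{g, gs}\<close> is open if no wall of the process separates \<open>gx\<^sub>0\<close> and \<open>gsx\<^sub>0\<close>. A finite set of
  edges is open with probability \<open>exp (- (1 - p) \<mu>(U))\<close>, where \<open>U\<close> is the union of the sets of
  walls separating their endpoints. These probabilities determine the law, hence its invariance.
  Taking a geodesic from \<open>o\<close> to \<open>g\<close> and bounding \<open>\<mu>(U)\<close> by subadditivity gives the lower
  bound on \<open>\<tau>(o, g)\<close>; for the upper bound, a wall separating \<open>x\<^sub>0\<close> and \<open>gx\<^sub>0\<close> separates the endpoints
  of some edge of any path from \<open>o\<close> to \<open>g\<close>.

  The process is only needed through its avoidance probabilities on countably many sets of finite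
  measure. To have the pair \<open>{o, g}\<close> at hand for the upper bound, the law is first constructed
  on all pairs of group elements and then restricted to the edges of the Cayley graph.\<close>

section \<open>Measurable structure on bond configurations\<close>

lemma space_configurations [simp]: "space (configurations E) = Pow E"
  unfolding configurations_def by (subst space_measure_of) auto

lemma sets_configurations:
  "sets (configurations E) = sigma_sets (Pow E) {{\<omega> \<in> Pow E. e \<in> \<omega>} | e. e \<in> E}"
  unfolding configurations_def by (subst sets_measure_of) auto

lemma edge_open_in_sets:
  "e \<in> E \<Longrightarrow> {\<omega> \<in> Pow E. e \<in> \<omega>} \<in> sets (configurations E)"
  unfolding sets_configurations by auto

lemma edges_open_in_sets:
  assumes "countable F" "F \<subseteq> E"
  shows "{\<omega> \<in> Pow E. F \<subseteq> \<omega>} \<in> sets (configurations E)"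
proof (cases "F = {}")
  case True
  then have "{\<omega> \<in> Pow E. F \<subseteq> \<omega>} = space (configurations E)" by auto
  then show ?thesis by (simp only: sets.top)
next
  case False
  have "(\<Inter>e\<in>F. {\<omega> \<in> Pow E. e \<in> \<omega>}) \<in> sets (configurations E)"
    using assms False by (intro sets.countable_INT' image_subsetI edge_open_in_sets) auto
  also have "(\<Inter>e\<in>F. {\<omega> \<in> Pow E. e \<in> \<omega>}) = {\<omega> \<in> Pow E. F \<subseteq> \<omega>}"
    using False by auto
  finally show ?thesis .
qed

lemma measurable_configurationsI:
  assumes "\<And>x. x \<in> space N \<Longrightarrow> f x \<subseteq> E"
    and "\<And>e. e \<in> E \<Longrightarrow> {x \<in> space N. e \<in> f x} \<in> sets N"
  shows "f \<in> measurable N (configurations E)"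
  unfolding configurations_def
proof (rule measurable_measure_of)
  fix Y assume "Y \<in> {{\<omega> \<in> Pow E. e \<in> \<omega>} | e. e \<in> E}"
  then obtain e where e: "e \<in> E" and Y: "Y = {\<omega> \<in> Pow E. e \<in> \<omega>}" by auto
  have "f -` Y \<inter> space N = {x \<in> space N. e \<in> f x}"
    unfolding Y using assms(1) by auto
  then show "f -` Y \<inter> space N \<in> sets N" using assms(2)[OF e] by simp
qed (use assms(1) in auto)

text \<open>The events that all edges of a finite set are open form a pi-system, since intersecting
  two of them amounts to uniting the edge sets, and they generate the sigma-algebra. The empty edge
  set supplies the whole space.\<close>

lemma configurations_measure_eqI:
  assumes "prob_space P" "prob_space Q"
    and sP: "sets P = sets (configurations E)" and sQ: "sets Q = sets (configurations E)"
    and eq: "\<And>F. finite F \<Longrightarrow> F \<subseteq> E \<Longrightarrow>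
      measure P {\<omega> \<in> Pow E. F \<subseteq> \<omega>} = measure Q {\<omega> \<in> Pow E. F \<subseteq> \<omega>}"
  shows "P = Q"
proof -
  interpret P: prob_space P by fact
  interpret Q: prob_space Q by fact
  let ?C = "{{\<omega> \<in> Pow E. F \<subseteq> \<omega>} | F. finite F \<and> F \<subseteq> E}"
  have sets_eq: "sets (configurations E) = sigma_sets (Pow E) ?C"
  proof
    show "sets (configurations E) \<subseteq> sigma_sets (Pow E) ?C"
      unfolding sets_configurations
    proof (rule sigma_sets_subseteq, clarify)
      fix e assume "e \<in> E"
      then show "\<exists>F. {\<omega> \<in> Pow E. e \<in> \<omega>} = {\<omega> \<in> Pow E. F \<subseteq> \<omega>} \<and> finite F \<and> F \<subseteq> E"
        by (intro exI[of _ "{e}"]) auto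
    qed
    have "?C \<subseteq> sets (configurations E)"
      using edges_open_in_sets countable_finite by blast
    then show "sigma_sets (Pow E) ?C \<subseteq> sets (configurations E)"
      using sets.sigma_sets_subset[of ?C "configurations E"] by simp
  qed
  show ?thesis
  proof (rule measure_eqI_generator_eq[where E = ?C and \<Omega> = "Pow E" and A = "\<lambda>_::nat. Pow E"])
    show "Int_stable ?C"
    proof (rule Int_stableI, clarify)
      fix F F' assume "finite F" "F \<subseteq> E" "finite F'" "F' \<subseteq> E"
      then show "\<exists>K. {\<omega> \<in> Pow E. F \<subseteq> \<omega>} \<inter> {\<omega> \<in> Pow E. F' \<subseteq> \<omega>} = {\<omega> \<in> Pow E. K \<subseteq> \<omega>}
          \<and> finite K \<and> K \<subseteq> E"
        by (intro exI[of _ "F \<union> F'"]) auto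
    qed
    show "range (\<lambda>_::nat. Pow E) \<subseteq> ?C"
      by (auto intro!: exI[of _ "{}"])
    show "\<And>Y. Y \<in> ?C \<Longrightarrow> emeasure P Y = emeasure Q Y"
      using eq by (auto simp: P.emeasure_eq_measure Q.emeasure_eq_measure)
  qed (use sP sQ sets_eq in \<open>auto\<close>)
qed

section \<open>Avoidance laws and their construction from Poisson processes\<close>

text \<open>The law of the random set of those \<open>e\<close> for which a Poisson process of
  intensity \<open>c\<close> times \<open>M\<close> has no point in \<open>W e\<close>. Recording
  only the avoidance probabilities of finite unions spares handling point processes as such. As
  \<open>measure\<close> is 0 on sets of infinite measure, the formula has this meaning for
  measurable sets of finite measure; the two existence lemmas below supply exactly such
  sets.\<close>

definition avoidance_law ::
    "'m measure \<Rightarrow> real \<Rightarrow> 'a set set \<Rightarrow> ('a set \<Rightarrow> 'm set) \<Rightarrow> 'a set set measure \<Rightarrow> bool" where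
  "avoidance_law M c E W P \<longleftrightarrow> prob_space P \<and> sets P = sets (configurations E) \<and>
     (\<forall>F. finite F \<longrightarrow> F \<subseteq> E \<longrightarrow>
        measure P {\<omega> \<in> Pow E. F \<subseteq> \<omega>} = exp (- c * measure M (\<Union>e\<in>F. W e)))"

lemma avoidance_lawD:
  assumes "avoidance_law M c E W P"
  shows "prob_space P" "sets P = sets (configurations E)"
    and "\<And>F. finite F \<Longrightarrow> F \<subseteq> E \<Longrightarrow>
      measure P {\<omega> \<in> Pow E. F \<subseteq> \<omega>} = exp (- c * measure M (\<Union>e\<in>F. W e))"
  using assms unfolding avoidance_law_def by simp_all

lemma avoidance_law_space: "avoidance_law M c E W P \<Longrightarrow> space P = Pow E"
  unfolding avoidance_law_def using sets_eq_imp_space_eq[of P "configurations E"] by simp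

text \<open>The generating function of the Poisson distribution, summed through the exponential
  series. With \<open>q\<close> the probability that one point misses a set, it is the probability
  that a Poisson number of independent points all miss it.\<close>

lemma poisson_power_generating:
  assumes "0 < r" "0 \<le> q"
  shows "(\<integral>\<^sup>+n. ennreal (q ^ n) \<partial>measure_pmf (poisson_pmf r)) = ennreal (exp (- r * (1 - q)))"
proof -
  have "(\<integral>\<^sup>+n. ennreal (q ^ n) \<partial>measure_pmf (poisson_pmf r))
      = (\<Sum>n. ennreal (exp (- r) * ((q * r) ^ n /\<^sub>R fact n)))"
    unfolding nn_integral_measure_pmf nn_integral_count_space_nat
    using assms by (intro suminf_cong)
      (simp add: ennreal_mult'[symmetric] power_mult_distrib field_simps)
  also have "\<dots> = ennreal (exp (- r) * exp (q * r))"
    using assms by (intro suminf_ennreal_eq sums_mult exp_converges) auto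
  also have "exp (- r) * exp (q * r) = exp (- r * (1 - q))"
    by (simp add: exp_add[symmetric] algebra_simps)
  finally show ?thesis .
qed

text \<open>The cell \<open>A\<close> carries a Poisson number of independent points distributed according to the
  normalised measure; an edge is open if none of these points falls into its set.\<close>

lemma avoidance_law_finite_measure:
  assumes A: "A \<in> sets M" "emeasure M A < \<infinity>" and c: "0 < c"
    and W: "\<And>e. e \<in> E \<Longrightarrow> W e \<in> sets M"
  shows "\<exists>Q. avoidance_law M c E (\<lambda>e. A \<inter> W e) Q"
proof (cases "measure M A = 0")
  case True
  \<comment> \<open>A cell of measure 0 cannot be normalised. All exponents vanish, so the
    deterministic configuration with every edge open has the required law.\<close>
  let ?Q = "return (configurations E) E"
  have "measure ?Q {\<omega> \<in> Pow E. F \<subseteq> \<omega>} = exp (- c * measure M (\<Union>e\<in>F. A \<inter> W e))"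
    if F: "finite F" "F \<subseteq> E" for F
  proof -
    have "measure M (\<Union>e\<in>F. A \<inter> W e) \<le> measure M A"
      using F A W by (intro measure_mono_fmeasurable) (auto intro!: sets.finite_UN fmeasurableI)
    then have "measure M (\<Union>e\<in>F. A \<inter> W e) = 0"
      using True by (simp add: measure_le_0_iff)
    moreover have "measure ?Q {\<omega> \<in> Pow E. F \<subseteq> \<omega>} = 1"
      using F by (subst measure_return) (auto intro!: edges_open_in_sets[simplified] countable_finite)
    ultimately show ?thesis by simp
  qed
  then show ?thesis
    unfolding avoidance_law_def by (intro exI[of _ ?Q]) (auto intro!: prob_space_return)
next
  case False
  \<comment> \<open>The mean number of points is the mass of the cell under the intensity.\<close>
  define r where "r = c * measure M A"
  have r: "0 < r"
    using False c by (simp add: r_def zero_less_measure_iff)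
  have A0: "emeasure M A \<noteq> 0" "emeasure M A \<noteq> \<infinity>"
    using False A by (auto simp: measure_def)
  define U where "U = uniform_measure M A"
  have sU [measurable_cong]: "sets U = sets M" and spU: "space U = space M"
    by (simp_all add: U_def)
  interpret U: prob_space U
    unfolding U_def using A0 by (rule prob_space_uniform_measure)
  interpret UU: product_prob_space "\<lambda>_::nat. U" UNIV ..
  \<comment> \<open>Infinitely many points are sampled, independently of the Poisson number, and
    only those with index below that number are looked at. The sample space is then a plain
    product.\<close>
  define Pt where "Pt = PiM (UNIV :: nat set) (\<lambda>_. U)"
  interpret Pt: prob_space Pt
    unfolding Pt_def by (rule UU.prob_space_axioms)
  define K where "K = measure_pmf (poisson_pmf r) \<Otimes>\<^sub>M Pt"
  interpret K: pair_prob_space "measure_pmf (poisson_pmf r)" Pt ..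
  have avoid: "{x \<in> space K. \<forall>i < fst x. snd x i \<notin> B} \<in> sets K" if [measurable]: "B \<in> sets M" for B
    unfolding K_def Pt_def by measurable
  define f where "f x = {e \<in> E. \<forall>i < fst x. snd x i \<notin> W e}" for x :: "nat \<times> (nat \<Rightarrow> 'a)"
  have f: "f \<in> measurable K (configurations E)"
    using avoid W by (intro measurable_configurationsI) (auto simp: f_def)
  have "measure (distr K (configurations E) f) {\<omega> \<in> Pow E. F \<subseteq> \<omega>}
      = exp (- c * measure M (\<Union>e\<in>F. A \<inter> W e))" if F: "finite F" "F \<subseteq> E" for F
  proof -
    define B where "B = (\<Union>e\<in>F. W e)"
    have B [measurable]: "B \<in> sets M"
      unfolding B_def using F W by (intro sets.finite_UN) auto
    define q where "q = measure U (space U - B)"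
    have q0: "0 \<le> q" by (simp add: q_def)
    have "q = 1 - measure U B"
      using U.prob_compl[of B] B by (simp add: q_def sU)
    moreover have "measure U B = measure M (A \<inter> B) / measure M A"
      unfolding U_def using A0 B by (rule measure_uniform_measure)
    ultimately have q: "1 - q = measure M (A \<inter> B) / measure M A"
      by linarith
    \<comment> \<open>One point hits \<open>B\<close> with probability \<open>1 - q\<close>, the
      share of \<open>A\<close> covered by \<open>B\<close>; multiplying by the mean number of
      points gives the intensity of \<open>A \<inter> B\<close>.\<close>
    have rq: "r * (1 - q) = c * measure M (\<Union>e\<in>F. A \<inter> W e)"
      using False by (simp add: q r_def B_def)
    have inner: "emeasure Pt (Pair n -` {x \<in> space K. \<forall>i < fst x. snd x i \<notin> B}) = ennreal (q ^ n)"
      for n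
    proof -
      have "Pair n -` {x \<in> space K. \<forall>i < fst x. snd x i \<notin> B}
          = {X \<in> space Pt. \<forall>i\<in>{..<n}. X i \<in> space U - B}"
        by (auto simp: K_def space_pair_measure Pt_def space_PiM)
      then show ?thesis
        unfolding Pt_def using B
        by (simp only:, subst UU.emeasure_PiM_Collect)
          (auto simp: sU spU U.emeasure_eq_measure q_def ennreal_power)
    qed
    \<comment> \<open>By Fubini: given \<open>n\<close> points, all of them miss \<open>B\<close>
      with probability \<open>q ^ n\<close>.\<close>
    have "emeasure K {x \<in> space K. \<forall>i < fst x. snd x i \<notin> B}
        = (\<integral>\<^sup>+n. ennreal (q ^ n) \<partial>measure_pmf (poisson_pmf r))"
      unfolding inner[symmetric] unfolding K_def
      by (intro Pt.emeasure_pair_measure_alt avoid[OF B, unfolded K_def])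
    also have "\<dots> = ennreal (exp (- r * (1 - q)))"
      using r q0 by (rule poisson_power_generating)
    finally have "measure K {x \<in> space K. \<forall>i < fst x. snd x i \<notin> B} = exp (- r * (1 - q))"
      by (simp add: measure_def)
    moreover have "f -` {\<omega> \<in> Pow E. F \<subseteq> \<omega>} \<inter> space K = {x \<in> space K. \<forall>i < fst x. snd x i \<notin> B}"
      using F by (auto simp: f_def B_def)
    ultimately show ?thesis
      using f F rq by (simp add: measure_distr edges_open_in_sets[simplified] countable_finite)
  qed
  then show ?thesis
    unfolding avoidance_law_def
    by (intro exI[of _ "distr K (configurations E) f"])
      (auto intro!: prob_space.prob_space_distr f simp: K_def[symmetric] K.prob_space_axioms[folded K_def])
qed

text \<open>Superposition of the laws of disjoint cells: an edge is open if it is open in all cells.\<close>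

lemma avoidance_law_exists:
  assumes E: "countable E" and c: "0 < c"
    and W: "\<And>e. e \<in> E \<Longrightarrow> W e \<in> sets M" "\<And>e. e \<in> E \<Longrightarrow> emeasure M (W e) < \<infinity>"
  shows "\<exists>P. avoidance_law M c E W P"
proof -
  \<comment> \<open>The membership test covers empty \<open>E\<close>, where
    \<open>from_nat_into\<close> takes an arbitrary value. Elements that the enumeration repeats
    contribute empty cells once the sequence is made disjoint.\<close>
  define V where "V n = (if from_nat_into E n \<in> E then W (from_nat_into E n) else {})" for n
  define A where "A = disjointed V"
  have V: "V n \<in> sets M" "emeasure M (V n) < \<infinity>" for n
    using W by (auto simp: V_def)
  then have "range A \<subseteq> sets M"
    unfolding A_def by (intro sets.range_disjointed_sets) auto
  then have A: "A n \<in> sets M" for n by auto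
  have A_fin: "emeasure M (A n) < \<infinity>" for n
    using emeasure_mono[OF disjointed_subset[of V n] V(1)] V(2)[of n]
    unfolding A_def by (rule le_less_trans)
  have "\<forall>n. \<exists>Q. avoidance_law M c E (\<lambda>e. A n \<inter> W e) Q"
    by (intro allI avoidance_law_finite_measure A A_fin c W(1))
  from choice[OF this] obtain Q where "\<forall>n. avoidance_law M c E (\<lambda>e. A n \<inter> W e) (Q n)" ..
  then have Q: "avoidance_law M c E (\<lambda>e. A n \<inter> W e) (Q n)" for n ..
  note Q_sets [measurable_cong] = avoidance_lawD(2)[OF Q]
  interpret product_prob_space Q UNIV
    using avoidance_lawD(1)[OF Q] by (intro product_prob_spaceI)
  define Pr where "Pr = PiM UNIV Q"
  interpret Pr: prob_space Pr
    unfolding Pr_def by (rule prob_space_axioms)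
  have cyl_sets: "{\<omega> \<in> space Pr. \<omega> n \<in> {x \<in> Pow E. F \<subseteq> x}} \<in> sets Pr"
    if F: "finite F" "F \<subseteq> E" for F n
  proof -
    have [measurable]: "{x \<in> Pow E. F \<subseteq> x} \<in> sets (Q n)"
      unfolding Q_sets using F by (intro edges_open_in_sets countable_finite)
    show ?thesis unfolding Pr_def by measurable
  qed
  define f where "f \<omega> = {e \<in> E. \<forall>n. e \<in> \<omega> n}" for \<omega> :: "nat \<Rightarrow> 'a set set"
  have sp: "\<omega> n \<subseteq> E" if "\<omega> \<in> space Pr" for \<omega> n
    using that avoidance_law_space[OF Q] by (auto simp: Pr_def space_PiM)
  have f: "f \<in> measurable Pr (configurations E)"
  proof (rule measurable_configurationsI)
    fix e assume e: "e \<in> E"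
    have "{\<omega> \<in> space Pr. \<forall>n. \<omega> n \<in> {x \<in> Pow E. {e} \<subseteq> x}} \<in> sets Pr"
      using cyl_sets[of "{e}"] e by (intro sets.sets_Collect_countable_All) auto
    also have "{\<omega> \<in> space Pr. \<forall>n. \<omega> n \<in> {x \<in> Pow E. {e} \<subseteq> x}} = {\<omega> \<in> space Pr. e \<in> f \<omega>}"
      using e sp by (auto simp: f_def)
    finally show "{\<omega> \<in> space Pr. e \<in> f \<omega>} \<in> sets Pr" .
  qed (auto simp: f_def)
  have "measure (distr Pr (configurations E) f) {\<omega> \<in> Pow E. F \<subseteq> \<omega>}
      = exp (- c * measure M (\<Union>e\<in>F. W e))" if F: "finite F" "F \<subseteq> E" for F
  proof -
    define B where "B = (\<Union>e\<in>F. W e)"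
    have B: "B \<in> sets M"
      unfolding B_def using F W by (intro sets.finite_UN) auto
    define Z where "Z N = {\<omega> \<in> space Pr. \<forall>n\<in>{0..<N}. \<omega> n \<in> {x \<in> Pow E. F \<subseteq> x}}" for N
    have Z_sets: "Z N \<in> sets Pr" for N
      unfolding Z_def using cyl_sets[OF F] by (intro sets.sets_Collect_finite_All) auto
    have Z_measure: "measure Pr (Z N) = exp (- c * measure M (\<Union>n\<in>{0..<N}. A n \<inter> B))" for N
    proof -
      \<comment> \<open>Independence of the cells turns the probability into a product, and their
        disjointness lets the exponents add up to the measure of a union.\<close>
      have "measure Pr (Z N) = (\<Prod>n\<in>{0..<N}. measure (Q n) {x \<in> Pow E. F \<subseteq> x})"
        unfolding Z_def Pr_def using F
        by (subst measure_def, subst emeasure_PiM_Collect)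
          (simp_all add: Q_sets edges_open_in_sets[simplified] countable_finite M.emeasure_eq_measure
            prod_ennreal prod_nonneg)
      also have "\<dots> = (\<Prod>n\<in>{0..<N}. exp (- c * measure M (A n \<inter> B)))"
        using avoidance_lawD(3)[OF Q F] unfolding B_def Int_UN_distrib by simp
      also have "\<dots> = exp (- c * (\<Sum>n\<in>{0..<N}. measure M (A n \<inter> B)))"
        by (simp add: exp_sum sum_distrib_left)
      also have "(\<Sum>n\<in>{0..<N}. measure M (A n \<inter> B)) = measure M (\<Union>n\<in>{0..<N}. A n \<inter> B)"
      proof (rule measure_finite_Union[symmetric])
        show "disjoint_family_on (\<lambda>n. A n \<inter> B) {0..<N}"
          using disjoint_family_disjointed[of V] unfolding A_def disjoint_family_on_def by blast
        show "emeasure M (A n \<inter> B) \<noteq> \<infinity>" for n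
          using le_less_trans[OF emeasure_mono A_fin[of n], of "A n \<inter> B"] A by auto
      qed (use A B in auto)
      finally show ?thesis .
    qed
    \<comment> \<open>The cells up to the largest index of an edge of \<open>F\<close> cover
      \<open>B\<close>, so the probability of \<open>Z N\<close> is constant from \<open>N0\<close>
      on and its limit can be read off.\<close>
    obtain N0 where N0: "\<And>e. e \<in> F \<Longrightarrow> to_nat_on E e < N0"
      using F(1) finite_nat_set_iff_bounded[of "to_nat_on E ` F"] by auto
    have "measure Pr (Z N) = exp (- c * measure M B)" if "N0 \<le> N" for N
    proof -
      have "B \<subseteq> (\<Union>n\<in>{0..<N}. V n)"
      proof
        fix x assume "x \<in> B"
        then obtain e where e: "e \<in> F" "x \<in> W e" unfolding B_def by auto
        then have "x \<in> V (to_nat_on E e)"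
          using E F by (auto simp: V_def)
        with N0[OF e(1)] that show "x \<in> (\<Union>n\<in>{0..<N}. V n)" by force
      qed
      then have "B \<subseteq> (\<Union>n\<in>{0..<N}. A n)"
        unfolding A_def finite_UN_disjointed_eq .
      then have "(\<Union>n\<in>{0..<N}. A n \<inter> B) = B" by auto
      then show ?thesis using Z_measure[of N] by simp
    qed
    then have "(\<lambda>N. measure Pr (Z N)) \<longlonglongrightarrow> exp (- c * measure M B)"
      by (intro tendsto_eventually eventually_sequentiallyI)
    moreover have "(\<lambda>N. measure Pr (Z N)) \<longlonglongrightarrow> measure Pr (\<Inter>N. Z N)"
      using Z_sets by (intro Pr.finite_Lim_measure_decseq) (auto simp: decseq_def Z_def)
    ultimately have "measure Pr (\<Inter>N. Z N) = exp (- c * measure M B)"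
      by (rule LIMSEQ_unique[rotated])
    moreover have "f -` {\<omega> \<in> Pow E. F \<subseteq> \<omega>} \<inter> space Pr = (\<Inter>N. Z N)"
    proof
      show "f -` {\<omega> \<in> Pow E. F \<subseteq> \<omega>} \<inter> space Pr \<subseteq> (\<Inter>N. Z N)"
        using F sp by (auto simp: f_def Z_def)
      show "(\<Inter>N. Z N) \<subseteq> f -` {\<omega> \<in> Pow E. F \<subseteq> \<omega>} \<inter> space Pr"
      proof
        fix \<omega> assume \<omega>: "\<omega> \<in> (\<Inter>N. Z N)"
        then have "\<omega> \<in> space Pr" by (auto simp: Z_def)
        moreover have "F \<subseteq> \<omega> n" for n
          using INT_D[OF \<omega>, of "Suc n"] by (auto simp: Z_def)
        ultimately show "\<omega> \<in> f -` {\<omega> \<in> Pow E. F \<subseteq> \<omega>} \<inter> space Pr"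
          using F by (auto simp: f_def)
      qed
    qed
    ultimately show ?thesis
      using f F by (simp add: measure_distr edges_open_in_sets[simplified] countable_finite B_def)
  qed
  then show ?thesis
    unfolding avoidance_law_def
    by (intro exI[of _ "distr Pr (configurations E) f"]) (auto intro!: Pr.prob_space_distr f)
qed

section \<open>Almost sure inclusions, restriction and invariance of avoidance laws\<close>

text \<open>Adding \<open>e\<close> to \<open>F\<close> leaves the union of the sets unchanged, so
  the event that \<open>F\<close> is open and its subevent that \<open>e\<close> is open as well
  have equal probability.\<close>

lemma avoidance_law_AE_open:
  assumes P: "avoidance_law M c E W P" and F: "finite F" "F \<subseteq> E" and e: "e \<in> E"
    and sub: "W e \<subseteq> (\<Union>e'\<in>F. W e')"
  shows "AE \<omega> in P. F \<subseteq> \<omega> \<longrightarrow> e \<in> \<omega>"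
proof -
  note sets_P = avoidance_lawD(2)[OF P] and law = avoidance_lawD(3)[OF P]
  interpret prob_space P by (rule avoidance_lawD(1)[OF P])
  let ?A = "{\<omega> \<in> Pow E. F \<subseteq> \<omega>}" and ?B = "{\<omega> \<in> Pow E. insert e F \<subseteq> \<omega>}"
  have meas: "?A \<in> sets P" "?B \<in> sets P"
    unfolding sets_P using F e by (intro edges_open_in_sets; simp add: countable_finite)+
  have "measure P (?A - ?B) = measure P ?A - measure P ?B"
    using meas by (intro finite_measure_Diff) auto
  also have "measure P ?B = measure P ?A"
    using law[of "insert e F"] law[of F] F e sub by (simp add: Un_absorb1)
  finally have "?A - ?B \<in> null_sets P"
    using meas by (auto simp: emeasure_eq_measure simp del: insert_subset)
  then show ?thesis
    by (rule AE_I') (auto simp: avoidance_law_space[OF P])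
qed

text \<open>Whether a set of edges of \<open>E'\<close> is open is not affected by intersecting the
  configuration with \<open>E'\<close>, so the avoidance probabilities carry over.\<close>

lemma avoidance_law_restrict:
  assumes P: "avoidance_law M c E W P" and sub: "E' \<subseteq> E"
  shows "avoidance_law M c E' W (distr P (configurations E') (\<lambda>\<omega>. \<omega> \<inter> E'))"
    and "(\<lambda>\<omega>. \<omega> \<inter> E') \<in> measurable P (configurations E')"
proof -
  note sets_P = avoidance_lawD(2)[OF P]
  interpret prob_space P by (rule avoidance_lawD(1)[OF P])
  show meas: "(\<lambda>\<omega>. \<omega> \<inter> E') \<in> measurable P (configurations E')"
  proof (rule measurable_configurationsI)
    fix e assume "e \<in> E'"
    then show "{\<omega> \<in> space P. e \<in> \<omega> \<inter> E'} \<in> sets P"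
      using edge_open_in_sets[of e E] sub by (auto simp: avoidance_law_space[OF P] sets_P)
  qed auto
  have "measure (distr P (configurations E') (\<lambda>\<omega>. \<omega> \<inter> E')) {\<omega> \<in> Pow E'. F \<subseteq> \<omega>}
      = exp (- c * measure M (\<Union>e\<in>F. W e))" if F: "finite F" "F \<subseteq> E'" for F
  proof -
    have "(\<lambda>\<omega>. \<omega> \<inter> E') -` {\<omega> \<in> Pow E'. F \<subseteq> \<omega>} \<inter> space P = {\<omega> \<in> Pow E. F \<subseteq> \<omega>}"
      using F by (auto simp: avoidance_law_space[OF P])
    then show ?thesis
      using F sub meas avoidance_lawD(3)[OF P, of F]
      by (subst measure_distr) (simp_all add: edges_open_in_sets[simplified] countable_finite)
  qed
  then show "avoidance_law M c E' W (distr P (configurations E') (\<lambda>\<omega>. \<omega> \<inter> E'))"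
    unfolding avoidance_law_def by (auto intro!: prob_space_distr meas)
qed

text \<open>Under \<open>t\<close>, the event that \<open>F\<close> is open pulls back to the event
  that the preimage of \<open>F\<close> is open. By \<open>inv\<close> the two are equally likely,
  and these probabilities determine the law.\<close>

lemma avoidance_law_measure_preserving:
  assumes P: "avoidance_law M c E W P" and t: "bij_betw t E E"
    and inv: "\<And>F. finite F \<Longrightarrow> F \<subseteq> E \<Longrightarrow>
      measure M (\<Union>e\<in>F. W (t e)) = measure M (\<Union>e\<in>F. W e)"
  shows "measure_preserving P ((`) t)"
proof -
  note sets_P = avoidance_lawD(2)[OF P] and law = avoidance_lawD(3)[OF P]
  interpret prob_space P by (rule avoidance_lawD(1)[OF P])
  have sp: "space P = Pow E" by (rule avoidance_law_space[OF P])
  have inj: "inj_on t E" and im: "t ` E = E"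
    using t by (auto simp: bij_betw_def)
  have "(`) t \<in> measurable P (configurations E)"
  proof (rule measurable_configurationsI)
    show "t ` \<omega> \<subseteq> E" if "\<omega> \<in> space P" for \<omega>
      using that im by (auto simp: sp)
    fix e assume "e \<in> E"
    then obtain e' where e': "e' \<in> E" "e = t e'" using im by auto
    have "{\<omega> \<in> space P. e \<in> t ` \<omega>} = {\<omega> \<in> Pow E. e' \<in> \<omega>}"
      using e' inj_on_image_mem_iff[OF inj e'(1)] by (auto simp: sp)
    then show "{\<omega> \<in> space P. e \<in> t ` \<omega>} \<in> sets P"
      using edge_open_in_sets[OF e'(1)] by (simp add: sets_P)
  qed
  then have meas: "(`) t \<in> measurable P P"
    by (simp add: measurable_cong_sets[OF refl sets_P])
  have "distr P P ((`) t) = P"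
  proof (rule configurations_measure_eqI)
    fix F assume F: "finite F" "F \<subseteq> E"
    define F' where "F' = {e \<in> E. t e \<in> F}"
    have "F \<subseteq> t ` E" using F(2) im by simp
    then have F': "F' \<subseteq> E" "F = t ` F'" unfolding F'_def by auto
    have fin: "finite F'"
      using F F' inj by (metis finite_imageD inj_on_subset)
    have "(`) t -` {\<omega> \<in> Pow E. F \<subseteq> \<omega>} \<inter> space P = {\<omega> \<in> Pow E. F' \<subseteq> \<omega>}"
      using image_mono[of _ E t] im inj_on_image_subset_iff[OF inj F'(1)] by (auto simp: sp F'(2))
    then have "measure (distr P P ((`) t)) {\<omega> \<in> Pow E. F \<subseteq> \<omega>} = measure P {\<omega> \<in> Pow E. F' \<subseteq> \<omega>}"
      using F meas by (subst measure_distr) (auto simp: sets_P intro!: edges_open_in_sets[simplified] countable_finite)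
    also have "\<dots> = measure P {\<omega> \<in> Pow E. F \<subseteq> \<omega>}"
      using law[OF fin F'(1)] law[OF F] inv[OF fin F'(1)] by (simp add: F'(2))
    finally show "measure (distr P P ((`) t)) {\<omega> \<in> Pow E. F \<subseteq> \<omega>} = measure P {\<omega> \<in> Pow E. F \<subseteq> \<omega>}" .
  qed (simp_all add: sets_P prob_space_distr[OF meas] prob_space_axioms)
  with meas show ?thesis unfolding measure_preserving_def by blast
qed

section \<open>Walls and separation\<close>

lemma separates_commute: "separates Wl x y \<longleftrightarrow> separates Wl y x"
  unfolding separates_def by blast

text \<open>Classes are disjoint, so a point lies in only one of them. If \<open>x\<close> and
  \<open>z\<close> lie in different classes, the class containing \<open>y\<close> differs from at
  least one of these two.\<close>

lemma wall_separates:
  assumes "wall X Wl"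
  shows not_separates_self: "\<not> separates Wl x x"
    and separates_triangle: "y \<in> X \<Longrightarrow> separates Wl x z \<Longrightarrow> separates Wl x y \<or> separates Wl y z"
proof -
  have part: "partition_on X Wl" using assms unfolding wall_def by blast
  then have "\<And>A B. A \<in> Wl \<Longrightarrow> B \<in> Wl \<Longrightarrow> A \<noteq> B \<Longrightarrow> A \<inter> B = {}"
    unfolding partition_on_def disjoint_def by blast
  then show "\<not> separates Wl x x"
    unfolding separates_def by blast
  assume "y \<in> X" "separates Wl x z"
  moreover from \<open>y \<in> X\<close> have "\<exists>C\<in>Wl. y \<in> C"
    using part unfolding partition_on_def by blast
  ultimately show "separates Wl x y \<or> separates Wl y z"
    unfolding separates_def by metis
qed

text \<open>Injectivity on \<open>X\<close> keeps distinct classes distinct and puts no new point of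
  the image into a class.\<close>

lemma separates_image:
  assumes Wl: "wall X Wl" and inj: "inj_on f X" and xy: "x \<in> X" "y \<in> X"
  shows "separates ((\<lambda>B. f ` B) ` Wl) (f x) (f y) \<longleftrightarrow> separates Wl x y"
proof -
  have sub: "B \<subseteq> X" if "B \<in> Wl" for B
    using that Wl unfolding wall_def partition_on_def by blast
  have mem: "f z \<in> f ` B \<longleftrightarrow> z \<in> B" if "B \<in> Wl" "z \<in> X" for z B
    using inj_on_image_mem_iff[OF inj that(2) sub[OF that(1)]] .
  have eq: "f ` A = f ` B \<longleftrightarrow> A = B" if "A \<in> Wl" "B \<in> Wl" for A B
    using inj_on_image_eq_iff[OF inj sub[OF that(1)] sub[OF that(2)]] .
  show ?thesis
    unfolding separates_def using mem eq xy by (simp add: bex_simps)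
qed

section \<open>Walls attached to pairs of group elements\<close>

locale measured_walls_action =
  fixes G :: "('a, 'c) monoid_scheme" (structure) and X :: "'b set"
    and M :: "'b set set measure" and \<phi> :: "'a \<Rightarrow> 'b \<Rightarrow> 'b" and x0 :: 'b
  assumes group_G: "group G"
    and walls: "measured_walls_space X M"
    and action: "invariant_walls_action G X M \<phi>"
    and x0: "x0 \<in> X"
begin

sublocale group G by (rule group_G)

sublocale group_action G X \<phi>
  using action unfolding invariant_walls_action_def by blast

definition edge_walls :: "'a set \<Rightarrow> 'b set set set" where
  "edge_walls e = {Wl \<in> space M. \<exists>a\<in>e. \<exists>b\<in>e. separates Wl (\<phi> a x0) (\<phi> b x0)}"

lemma wall_in_space: "Wl \<in> space M \<Longrightarrow> wall X Wl"
  using walls unfolding measured_walls_space_def by blast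

lemma orbit_in_space: "a \<in> carrier G \<Longrightarrow> \<phi> a x0 \<in> X"
  using element_image x0 by blast

text \<open>Of the choices of two endpoints, those with equal endpoints separate nothing, and the
  remaining ones agree by symmetry.\<close>

lemma edge_walls_pair:
  "edge_walls {a, b} = separating_walls M (\<phi> a x0) (\<phi> b x0)"
proof -
  have "(\<exists>c\<in>{a, b}. \<exists>d\<in>{a, b}. separates Wl (\<phi> c x0) (\<phi> d x0)) \<longleftrightarrow> separates Wl (\<phi> a x0) (\<phi> b x0)"
    if "Wl \<in> space M" for Wl
    using not_separates_self[OF wall_in_space[OF that]] separates_commute[of Wl "\<phi> a x0" "\<phi> b x0"]
    by auto
  then show ?thesis
    unfolding edge_walls_def separating_walls_def by (auto simp only: mem_Collect_eq)
qed

lemma edge_walls_finite_measure: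
  assumes "a \<in> carrier G" "b \<in> carrier G"
  shows "edge_walls {a, b} \<in> sets M" "emeasure M (edge_walls {a, b}) < \<infinity>"
proof -
  \<comment> \<open>Distinct group elements may send \<open>x0\<close> to the same point, whereas
    the finiteness assumption on walls speaks of distinct points.\<close>
  have "separating_walls M x x = {}" for x
    using not_separates_self[OF wall_in_space] unfolding separating_walls_def by blast
  then have "edge_walls {a, b} \<in> sets M \<and> emeasure M (edge_walls {a, b}) < \<infinity>"
    using walls orbit_in_space[OF assms(1)] orbit_in_space[OF assms(2)]
    unfolding edge_walls_pair measured_walls_space_def
    by (cases "\<phi> a x0 = \<phi> b x0") auto
  then show "edge_walls {a, b} \<in> sets M" "emeasure M (edge_walls {a, b}) < \<infinity>"
    by blast+
qed

text \<open>The case \<open>a = b\<close> is included: it accounts for loops of the Cayley graph and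
  for the pair used in the upper bound when \<open>g\<close> is the identity.\<close>

definition pairs :: "'a set set" where
  "pairs = {{a, b} | a b. a \<in> carrier G \<and> b \<in> carrier G}"

lemma edge_walls_pairs:
  assumes "e \<in> pairs"
  shows "edge_walls e \<in> sets M" "emeasure M (edge_walls e) < \<infinity>"
  using assms edge_walls_finite_measure unfolding pairs_def by auto

text \<open>The action of \<open>g\<close> takes a wall to one separating the translated endpoints
  exactly if the wall separates the original ones. Hence the union on the right is the preimage of
  the one on the left under a measure preserving map.\<close>

lemma edge_walls_translate:
  assumes g: "g \<in> carrier G" and F: "finite F" "F \<subseteq> pairs"
  shows "measure M (\<Union>e\<in>F. edge_walls ((\<otimes>) g ` e)) = measure M (\<Union>e\<in>F. edge_walls e)"
proof -
  let ?T = "\<lambda>Wl. (\<lambda>B. \<phi> g ` B) ` Wl"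
  let ?Z = "\<Union>e\<in>F. edge_walls ((\<otimes>) g ` e)"
  have T: "?T \<in> measurable M M" and distr: "distr M M ?T = M"
    using action g unfolding invariant_walls_action_def measure_preserving_def by blast+
  have pair: "(\<otimes>) g ` e \<in> pairs" if "e \<in> pairs" for e
    using that g unfolding pairs_def by auto
  then have Z: "?Z \<in> sets M"
    using F edge_walls_pairs(1) by (intro sets.finite_UN) auto
  have "?T -` edge_walls ((\<otimes>) g ` e) \<inter> space M = edge_walls e" if e: "e \<in> pairs" for e
  proof -
    have sep: "separates (?T Wl) (\<phi> (g \<otimes> a) x0) (\<phi> (g \<otimes> b) x0) \<longleftrightarrow> separates Wl (\<phi> a x0) (\<phi> b x0)"
      if "Wl \<in> space M" "a \<in> e" "b \<in> e" for Wl a b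
    proof -
      have "a \<in> carrier G" "b \<in> carrier G" using that e unfolding pairs_def by auto
      then show ?thesis
        using separates_image[OF wall_in_space[OF that(1)] inj_prop[OF g]] orbit_in_space
        by (simp add: composition_rule[OF x0 g])
    qed
    have "?T Wl \<in> edge_walls ((\<otimes>) g ` e) \<longleftrightarrow> Wl \<in> edge_walls e" if "Wl \<in> space M" for Wl
      unfolding edge_walls_def
      using measurable_space[OF T that] that by (simp add: sep cong: bex_cong)
    moreover have "edge_walls e \<subseteq> space M" unfolding edge_walls_def by blast
    ultimately show ?thesis by blast
  qed
  then have "?T -` ?Z \<inter> space M = (\<Union>e\<in>F. edge_walls e)"
    using F(2) by blast
  then show ?thesis
    using measure_distr[OF T Z] distr by simp
qed

text \<open>By induction along the path: a wall separating \<open>a\<close> from \<open>b'\<close>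
  separates \<open>a\<close> from \<open>b\<close> or \<open>b\<close> from \<open>b'\<close>. This
  is the deterministic part of the upper bound on the two-point function.\<close>

lemma edge_walls_path:
  assumes "(a, b) \<in> (adjacency F)\<^sup>*" "F \<subseteq> pairs" "a \<in> carrier G"
  shows "b \<in> carrier G \<and> edge_walls {a, b} \<subseteq> (\<Union>e\<in>F. edge_walls e)"
  using assms
proof (induction rule: rtrancl_induct)
  case base
  then show ?case
    using not_separates_self[OF wall_in_space] unfolding edge_walls_def by auto
next
  case (step b b')
  then have b: "b \<in> carrier G" "edge_walls {a, b} \<subseteq> (\<Union>e\<in>F. edge_walls e)" and e: "{b, b'} \<in> F"
    unfolding adjacency_def by auto
  then have "{b, b'} \<in> pairs" using step.prems by blast
  then have "b' \<in> carrier G" unfolding pairs_def by (auto simp: doubleton_eq_iff)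
  moreover have "edge_walls {a, b'} \<subseteq> edge_walls {a, b} \<union> edge_walls {b, b'}"
    using separates_triangle[OF wall_in_space orbit_in_space[OF b(1)]]
    unfolding edge_walls_pair separating_walls_def by blast
  ultimately show ?case using b(2) e by blast
qed

end

section \<open>Paths and Cayley graphs\<close>

lemma adjacency_rtrancl_mono: "\<omega> \<subseteq> \<omega>' \<Longrightarrow> (adjacency \<omega>)\<^sup>* \<subseteq> (adjacency \<omega>')\<^sup>*"
  unfolding adjacency_def by (intro rtrancl_mono) auto

text \<open>A path uses finitely many edges; this reduces connection events to events about finite
  edge sets.\<close>

lemma connected_by_finitely_many_edges:
  assumes "(x, y) \<in> (adjacency \<omega>)\<^sup>*"
  obtains F where "finite F" "F \<subseteq> \<omega>" "(x, y) \<in> (adjacency F)\<^sup>*"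
proof -
  have "\<exists>F. finite F \<and> F \<subseteq> \<omega> \<and> (x, y) \<in> (adjacency F)\<^sup>*"
    using assms
  proof (induction rule: rtrancl_induct)
    case base
    then show ?case by (intro exI[of _ "{}"]) auto
  next
    case (step y z)
    then obtain F where F: "finite F" "F \<subseteq> \<omega>" "(x, y) \<in> (adjacency F)\<^sup>*" by blast
    have "(x, y) \<in> (adjacency (insert {y, z} F))\<^sup>*"
      using F(3) adjacency_rtrancl_mono[of F "insert {y, z} F"] by blast
    moreover have "(y, z) \<in> adjacency (insert {y, z} F)"
      unfolding adjacency_def by simp
    ultimately have "(x, z) \<in> (adjacency (insert {y, z} F))\<^sup>*" by (rule rtrancl_into_rtrancl)
    moreover have "{y, z} \<in> \<omega>" using step.hyps(2) by (simp add: adjacency_def)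
    ultimately show ?case using F by (intro exI[of _ "insert {y, z} F"]) simp
  qed
  then show ?thesis using that by blast
qed

text \<open>An edge can be read from either end. Read from \<open>g \<otimes> s\<close>, it is
  multiplication by \<open>inv s\<close>, which lies in \<open>S\<close> by symmetry.\<close>

lemma (in group) adjacency_cayley_edges:
  assumes S: "symmetric_generating_set G S" and x: "x \<in> carrier G"
  shows "(x, y) \<in> adjacency (cayley_edges G S) \<longleftrightarrow> (\<exists>s\<in>S. y = x \<otimes> s)"
proof
  assume "(x, y) \<in> adjacency (cayley_edges G S)"
  then obtain g s where g: "g \<in> carrier G" "s \<in> S" "{x, y} = {g, g \<otimes> s}"
    unfolding adjacency_def cayley_edges_def by auto
  have s: "s \<in> carrier G" "inv s \<in> S"
    using S g unfolding symmetric_generating_set_def by auto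
  from g(3) consider "x = g" "y = g \<otimes> s" | "x = g \<otimes> s" "y = g"
    by (auto simp: doubleton_eq_iff)
  then show "\<exists>s\<in>S. y = x \<otimes> s"
  proof cases
    case 2
    then have "y = x \<otimes> inv s" using g s by (simp add: m_assoc)
    then show ?thesis using s by blast
  qed (use g in blast)
qed (use x in \<open>auto simp: adjacency_def cayley_edges_def\<close>)

text \<open>The starting vertex is arbitrary so that, for a product \<open>h1 \<otimes> h2\<close>,
  the path given by \<open>h2\<close> can start at \<open>x \<otimes> h1\<close>.\<close>

lemma (in group) cayley_edges_adjacent:
  assumes S: "symmetric_generating_set G S" and g: "g \<in> carrier G" and x: "x \<in> carrier G"
  shows "(x, x \<otimes> g) \<in> (adjacency (cayley_edges G S))\<^sup>*"
proof -
  have sub: "S \<subseteq> carrier G" and gen: "generate G S = carrier G"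
    and inv_S: "\<And>s. s \<in> S \<Longrightarrow> inv s \<in> S"
    using S unfolding symmetric_generating_set_def by auto
  have "g \<in> generate G S" using g gen by simp
  then show ?thesis using x
  proof (induction arbitrary: x rule: generate.induct)
    case (incl h)
    then show ?case using adjacency_cayley_edges[OF S] by blast
  next
    case (inv h)
    then show ?case using adjacency_cayley_edges[OF S] inv_S[OF inv.hyps] by blast
  next
    case (eng h1 h2)
    then have h: "h1 \<in> carrier G" "h2 \<in> carrier G" using gen by auto
    have "(x, x \<otimes> h1) \<in> (adjacency (cayley_edges G S))\<^sup>*"
      "(x \<otimes> h1, x \<otimes> h1 \<otimes> h2) \<in> (adjacency (cayley_edges G S))\<^sup>*"
      using eng h by auto
    then show ?case using h eng.prems by (simp add: m_assoc)
  qed simp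
qed

text \<open>By connectedness some path length exists, so the \<open>LEAST\<close> defining the
  distance is attained.\<close>

lemma (in group) word_length_path:
  assumes "symmetric_generating_set G S" "g \<in> carrier G"
  shows "(\<one>, g) \<in> adjacency (cayley_edges G S) ^^ word_length G S g"
proof -
  have "(\<one>, g) \<in> (adjacency (cayley_edges G S))\<^sup>*"
    using cayley_edges_adjacent[OF assms one_closed] assms by simp
  then show ?thesis
    unfolding word_length_def graph_dist_def rtrancl_power by (elim exE) (rule LeastI)
qed

text \<open>Every element is the endpoint of a walk from the identity, and each step of a walk
  multiplies by one of finitely many generators.\<close>

lemma (in group) countable_carrier:
  assumes "finite S" and S: "symmetric_generating_set G S"
  shows "countable (carrier G)"
proof -
  let ?R = "adjacency (cayley_edges G S)"
  have sub: "S \<subseteq> carrier G" using S unfolding symmetric_generating_set_def by blast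
  have "countable ((?R ^^ n) `` {\<one>}) \<and> (?R ^^ n) `` {\<one>} \<subseteq> carrier G" for n
  proof (induction n)
    case (Suc n)
    let ?A = "(\<lambda>(x, s). x \<otimes> s) ` (((?R ^^ n) `` {\<one>}) \<times> S)"
    have "(?R ^^ Suc n) `` {\<one>} \<subseteq> ?A"
    proof
      fix z assume "z \<in> (?R ^^ Suc n) `` {\<one>}"
      then obtain y where y: "y \<in> (?R ^^ n) `` {\<one>}" "(y, z) \<in> ?R" by auto
      then have "y \<in> carrier G" using Suc.IH by blast
      then obtain s where "s \<in> S" "z = y \<otimes> s"
        using adjacency_cayley_edges[OF S] y(2) by blast
      then show "z \<in> ?A" using y(1) by (intro image_eqI[of _ _ "(y, s)"]) auto
    qed
    moreover have "countable ?A"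
      using Suc.IH assms(1) by (intro countable_image countable_SIGMA) (auto intro: countable_finite)
    moreover have "?A \<subseteq> carrier G" using Suc.IH sub by auto
    ultimately show ?case using countable_subset by blast
  qed simp
  then have "countable (\<Union>n. (?R ^^ n) `` {\<one>})" by blast
  moreover have "carrier G \<subseteq> (\<Union>n. (?R ^^ n) `` {\<one>})"
    using word_length_path[OF S] by blast
  ultimately show ?thesis by (rule countable_subset[rotated])
qed

lemma (in group) neighbours_one:
  assumes "symmetric_generating_set G S"
  shows "neighbours (cayley_edges G S) \<one> = S"
proof -
  have "\<one> \<otimes> s = s" if "s \<in> S" for s
    using assms that unfolding symmetric_generating_set_def by auto
  then show ?thesis
    unfolding neighbours_def adjacency_cayley_edges[OF assms one_closed] by (simp cong: bex_cong)
qed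

lemma (in group) finite_edges_at_one:
  assumes "finite S" and S: "symmetric_generating_set G S"
  shows "finite {e \<in> cayley_edges G S. \<one> \<in> e}"
proof (rule finite_subset)
  show "{e \<in> cayley_edges G S. \<one> \<in> e} \<subseteq> (\<lambda>s. {\<one>, s}) ` S"
  proof
    fix e assume "e \<in> {e \<in> cayley_edges G S. \<one> \<in> e}"
    then have "\<exists>y. e = {\<one>, y}" and e: "e \<in> cayley_edges G S"
      unfolding cayley_edges_def by auto
    then obtain y where "e = {\<one>, y}" "(\<one>, y) \<in> adjacency (cayley_edges G S)"
      unfolding adjacency_def by auto
    then show "e \<in> (\<lambda>s. {\<one>, s}) ` S"
      using neighbours_one[OF S] unfolding neighbours_def by auto
  qed
qed (use assms in simp)

text \<open>Left translation commutes with the right multiplications that define the edges, and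
  translation by \<open>inv g\<close> undoes translation by \<open>g\<close>.\<close>

lemma (in group) bij_betw_translate_cayley_edges:
  assumes S: "symmetric_generating_set G S" and g: "g \<in> carrier G"
  shows "bij_betw ((`) ((\<otimes>) g)) (cayley_edges G S) (cayley_edges G S)"
proof (rule bij_betw_byWitness[where f' = "(`) ((\<otimes>) (inv g))"])
  have sub: "S \<subseteq> carrier G" using S unfolding symmetric_generating_set_def by blast
  have maps: "(`) ((\<otimes>) h) ` cayley_edges G S \<subseteq> cayley_edges G S" if h: "h \<in> carrier G" for h
  proof clarify
    fix e assume "e \<in> cayley_edges G S"
    then obtain x s where "x \<in> carrier G" "s \<in> S" "e = {x, x \<otimes> s}"
      unfolding cayley_edges_def by auto
    then have "(\<otimes>) h ` e = {h \<otimes> x, h \<otimes> x \<otimes> s}" "h \<otimes> x \<in> carrier G" "s \<in> S"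
      using h sub by (auto simp: m_assoc)
    then show "(\<otimes>) h ` e \<in> cayley_edges G S"
      unfolding cayley_edges_def by blast
  qed
  show "(`) ((\<otimes>) g) ` cayley_edges G S \<subseteq> cayley_edges G S"
    "(`) ((\<otimes>) (inv g)) ` cayley_edges G S \<subseteq> cayley_edges G S"
    using maps g by simp_all
  have cancel: "(\<otimes>) h ` (\<otimes>) k ` e = e"
    if "h \<in> carrier G" "k \<in> carrier G" "h \<otimes> k = \<one>" "e \<in> cayley_edges G S" for h k e
  proof -
    have e: "e \<subseteq> carrier G" using that sub unfolding cayley_edges_def by auto
    then have "h \<otimes> (k \<otimes> x) = x" if "x \<in> e" for x
      using that \<open>h \<in> carrier G\<close> \<open>k \<in> carrier G\<close> \<open>h \<otimes> k = \<one>\<close> by (metis l_one m_assoc subsetD)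
    then show ?thesis by (simp add: image_image)
  qed
  show "\<forall>e\<in>cayley_edges G S. (\<otimes>) (inv g) ` (\<otimes>) g ` e = e"
    "\<forall>e\<in>cayley_edges G S. (\<otimes>) g ` (\<otimes>) (inv g) ` e = e"
    using cancel g by simp_all
qed

section \<open>Wall measures along edges and paths\<close>

context measured_walls_action
begin

lemma cayley_edges_subset_pairs:
  assumes "symmetric_generating_set G S"
  shows "cayley_edges G S \<subseteq> pairs"
  using assms unfolding symmetric_generating_set_def cayley_edges_def pairs_def by auto

text \<open>By invariance the edge \<open>{x, x \<otimes> s}\<close> can be moved to
  \<open>{\<one>, s}\<close>, and \<open>s\<close> is a neighbour of the identity.\<close>

lemma edge_walls_le_max_displacement:
  assumes "finite S" and S: "symmetric_generating_set G S" and e: "e \<in> cayley_edges G S"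
  shows "measure M (edge_walls e) \<le> max_displacement G S M \<phi> x0"
proof -
  obtain x s where xs: "x \<in> carrier G" "s \<in> S" "e = {x, x \<otimes> s}"
    using e unfolding cayley_edges_def by auto
  have s: "s \<in> carrier G" using xs S unfolding symmetric_generating_set_def by blast
  have "measure M (edge_walls e) = measure M (edge_walls {\<one>, s})"
    using edge_walls_translate[OF xs(1), of "{{\<one>, s}}"] xs s unfolding pairs_def by auto
  also have "\<dots> = wall_dist M x0 (\<phi> s x0)"
    unfolding edge_walls_pair wall_dist_def using id_eq_one x0 by (metis restrict_apply')
  also have "\<dots> \<le> max_displacement G S M \<phi> x0"
    unfolding max_displacement_def neighbours_one[OF S] using assms(1) xs(2) by (intro Max_ge) auto
  finally show ?thesis .
qed

text \<open>Subadditivity along the path: each step adds the walls of one edge. The bound counts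
  steps, so it also holds when the path repeats an edge and \<open>F\<close> does not grow.\<close>

lemma path_walls_le:
  assumes "finite S" and S: "symmetric_generating_set G S"
    and "(\<one>, g) \<in> adjacency (cayley_edges G S) ^^ n"
  shows "\<exists>F. finite F \<and> F \<subseteq> cayley_edges G S \<and> (\<one>, g) \<in> (adjacency F)\<^sup>* \<and>
    measure M (\<Union>e\<in>F. edge_walls e) \<le> real n * max_displacement G S M \<phi> x0"
  using assms(3)
proof (induction n arbitrary: g)
  case 0
  then show ?case by (intro exI[of _ "{}"]) auto
next
  case (Suc n)
  then obtain y where y: "(\<one>, y) \<in> adjacency (cayley_edges G S) ^^ n" "{y, g} \<in> cayley_edges G S"
    by (auto simp: adjacency_def)
  then obtain F where F: "finite F" "F \<subseteq> cayley_edges G S" "(\<one>, y) \<in> (adjacency F)\<^sup>*"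
    "measure M (\<Union>e\<in>F. edge_walls e) \<le> real n * max_displacement G S M \<phi> x0"
    using Suc.IH by blast
  let ?F = "insert {y, g} F"
  have "(\<one>, y) \<in> (adjacency ?F)\<^sup>*"
    using F(3) adjacency_rtrancl_mono[of F ?F] by blast
  moreover have "(y, g) \<in> adjacency ?F" unfolding adjacency_def by simp
  ultimately have "(\<one>, g) \<in> (adjacency ?F)\<^sup>*" by simp
  moreover have "measure M (\<Union>e\<in>?F. edge_walls e) \<le> real (Suc n) * max_displacement G S M \<phi> x0"
  proof -
    have "edge_walls e \<in> sets M" if "e \<in> ?F" for e
      using that edge_walls_pairs(1) cayley_edges_subset_pairs[OF S] F y by blast
    then have "measure M (\<Union>e\<in>?F. edge_walls e)
        \<le> measure M (edge_walls {y, g}) + measure M (\<Union>e\<in>F. edge_walls e)"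
      unfolding UN_insert using F(1) by (intro measure_Un_le sets.finite_UN) auto
    also have "\<dots> \<le> real (Suc n) * max_displacement G S M \<phi> x0"
      using F(4) edge_walls_le_max_displacement[OF assms(1) S y(2)] by (simp add: algebra_simps)
    finally show ?thesis .
  qed
  ultimately show ?case
    using F y by (intro exI[of _ ?F]) auto
qed

end

section \<open>Connection events\<close>

lemma cluster_event:
  assumes "\<omega> \<subseteq> E"
  shows "h \<in> cluster \<omega> g \<longleftrightarrow>
    (\<exists>F\<in>{F. finite F \<and> F \<subseteq> E \<and> (g, h) \<in> (adjacency F)\<^sup>*}. F \<subseteq> \<omega>)"
proof
  assume "h \<in> cluster \<omega> g"
  then have "(g, h) \<in> (adjacency \<omega>)\<^sup>*" by (simp add: cluster_def)
  then obtain F where "finite F" "F \<subseteq> \<omega>" "(g, h) \<in> (adjacency F)\<^sup>*"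
    by (rule connected_by_finitely_many_edges)
  then show "\<exists>F\<in>{F. finite F \<and> F \<subseteq> E \<and> (g, h) \<in> (adjacency F)\<^sup>*}. F \<subseteq> \<omega>"
    using assms by blast
next
  assume "\<exists>F\<in>{F. finite F \<and> F \<subseteq> E \<and> (g, h) \<in> (adjacency F)\<^sup>*}. F \<subseteq> \<omega>"
  then show "h \<in> cluster \<omega> g"
    using adjacency_rtrancl_mono unfolding cluster_def by blast
qed

text \<open>There are only countably many finite edge sets, and the connection event is the union,
  over those that join \<open>g\<close> to \<open>h\<close>, of the events that all their edges are
  open.\<close>

lemma cluster_event_in_sets:
  assumes "countable E"
  shows "{\<omega> \<in> Pow E. h \<in> cluster \<omega> g} \<in> sets (configurations E)"
proof -
  let ?\<F> = "{F. finite F \<and> F \<subseteq> E \<and> (g, h) \<in> (adjacency F)\<^sup>*}"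
  have "countable ?\<F>"
    using countable_Collect_finite_subset[OF assms] by (rule countable_subset[rotated]) auto
  then have "(\<Union>F\<in>?\<F>. {\<omega> \<in> Pow E. F \<subseteq> \<omega>}) \<in> sets (configurations E)"
    by (rule sets.countable_UN') (auto intro!: edges_open_in_sets[simplified] countable_finite)
  also have "(\<Union>F\<in>?\<F>. {\<omega> \<in> Pow E. F \<subseteq> \<omega>}) = {\<omega> \<in> Pow E. h \<in> cluster \<omega> g}"
    by (auto simp: cluster_event[of _ E h g])
  finally show ?thesis .
qed

section \<open>The percolation and its properties\<close>

theorem theorem3p7:
  fixes G :: "('a, 'c) monoid_scheme" and S :: "'a set"
    and X :: "'b set" and M :: "'b set set measure" and \<phi> :: "'a \<Rightarrow> 'b \<Rightarrow> 'b"
    and x0 :: 'b and p \<alpha> :: real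
  assumes "group G" and "infinite (carrier G)"
    and "finite S" and "symmetric_generating_set G S"
    and "measured_walls_space X M" and "invariant_walls_action G X M \<phi>"
    and "x0 \<in> X"
    and "0 < p" and "p < 1"
    and "\<alpha> = exp (- (1 - p) * max_displacement G S M \<phi> x0)"
  shows "\<exists>P. invariant_bond_percolation G S P \<and>
           (\<integral>\<omega>. real (vertex_degree \<omega> \<one>\<^bsub>G\<^esub>) \<partial>P) \<ge> \<alpha> * real (vertex_degree (cayley_edges G S) \<one>\<^bsub>G\<^esub>) \<and>
           (\<forall>g\<in>carrier G.
              exp (- (1 - p) * max_displacement G S M \<phi> x0 * real (word_length G S g))
                \<le> two_point P \<one>\<^bsub>G\<^esub> g \<and>
              two_point P \<one>\<^bsub>G\<^esub> g \<le> exp (- (1 - p) * wall_dist M x0 (\<phi> g x0)))"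
proof -
  interpret measured_walls_action G X M \<phi> x0
    using assms(1,5,6,7) by (rule measured_walls_action.intro)
  define E where "E = cayley_edges G S"
  define D where "D = max_displacement G S M \<phi> x0"
  define c where "c = 1 - p"
  have c: "0 < c" using assms by (simp add: c_def)
  have \<alpha>: "\<alpha> = exp (- c * D)" using assms(10) by (simp only: c_def D_def)
  note S = assms(3,4)
  have E_pairs: "E \<subseteq> pairs"
    unfolding E_def by (rule cayley_edges_subset_pairs[OF S(2)])
  have "pairs = (\<lambda>(a, b). {a, b}) ` (carrier G \<times> carrier G)"
    unfolding pairs_def by auto
  then have pairs_countable: "countable pairs"
    using countable_carrier[OF S] by simp
  have E_countable: "countable E"
    using E_pairs pairs_countable by (rule countable_subset)
  have "\<exists>P'. avoidance_law M c pairs edge_walls P'"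
    by (intro avoidance_law_exists pairs_countable c edge_walls_pairs)
  then obtain P' where P': "avoidance_law M c pairs edge_walls P'" ..
  interpret P': prob_space P' by (rule avoidance_lawD(1)[OF P'])
  define P where "P = distr P' (configurations E) (\<lambda>\<omega>. \<omega> \<inter> E)"
  have restrict: "(\<lambda>\<omega>. \<omega> \<inter> E) \<in> measurable P' (configurations E)"
    by (rule avoidance_law_restrict(2)[OF P' E_pairs])
  have P: "avoidance_law M c E edge_walls P"
    unfolding P_def by (rule avoidance_law_restrict(1)[OF P' E_pairs])
  note sets_P = avoidance_lawD(2)[OF P] and law = avoidance_lawD(3)[OF P]
    and space_P = avoidance_law_space[OF P]
  interpret P: prob_space P by (rule avoidance_lawD(1)[OF P])

  \<comment> \<open>Invariance under the group\<close>
  have invariant: "invariant_bond_percolation G S P"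
    unfolding invariant_bond_percolation_def
  proof (intro conjI ballI)
    show "prob_space P" by (rule P.prob_space_axioms)
    show "sets P = sets (configurations (cayley_edges G S))" using sets_P by (simp add: E_def)
    fix g assume g: "g \<in> carrier G"
    have "measure_preserving P ((`) ((`) ((\<otimes>\<^bsub>G\<^esub>) g)))"
    proof (rule avoidance_law_measure_preserving[OF P])
      show "bij_betw ((`) ((\<otimes>\<^bsub>G\<^esub>) g)) E E"
        unfolding E_def by (rule bij_betw_translate_cayley_edges[OF S(2) g])
      show "measure M (\<Union>e\<in>F. edge_walls ((\<otimes>\<^bsub>G\<^esub>) g ` e)) = measure M (\<Union>e\<in>F. edge_walls e)"
        if "finite F" "F \<subseteq> E" for F
        using that E_pairs by (intro edge_walls_translate g) auto
    qed
    moreover have "translate G g = (`) ((`) ((\<otimes>\<^bsub>G\<^esub>) g))"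
      unfolding translate_def fun_eq_iff by simp
    ultimately show "measure_preserving P (translate G g)" by simp
  qed

  \<comment> \<open>Expected degree of the identity\<close>
  have degree: "\<alpha> * real (vertex_degree (cayley_edges G S) \<one>\<^bsub>G\<^esub>)
      \<le> (\<integral>\<omega>. real (vertex_degree \<omega> \<one>\<^bsub>G\<^esub>) \<partial>P)"
  proof -
    define E1 where "E1 = {e \<in> E. \<one>\<^bsub>G\<^esub> \<in> e}"
    have fin: "finite E1"
      unfolding E1_def E_def by (rule finite_edges_at_one[OF S])
    have open_sets: "{\<omega> \<in> Pow E. e \<in> \<omega>} \<in> sets P" if "e \<in> E1" for e
      unfolding sets_P using that by (intro edge_open_in_sets) (simp add: E1_def)
    have open_prob: "\<alpha> \<le> measure P {\<omega> \<in> Pow E. e \<in> \<omega>}" if "e \<in> E1" for e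
    proof -
      have e: "e \<in> E" using that by (simp add: E1_def)
      then have "c * measure M (edge_walls e) \<le> c * D"
        using edge_walls_le_max_displacement[OF S] c unfolding D_def E_def by simp
      then show ?thesis
        using law[of "{e}"] e by (simp add: \<alpha>)
    qed
    \<comment> \<open>The degree counts the open edges among the finitely many at the identity. By
      linearity its expectation is a sum of probabilities, each of which is at least
      \<alpha>.\<close>
    have "(\<integral>\<omega>. real (vertex_degree \<omega> \<one>\<^bsub>G\<^esub>) \<partial>P)
        = (\<integral>\<omega>. (\<Sum>e\<in>E1. indicator {\<omega> \<in> Pow E. e \<in> \<omega>} \<omega>) \<partial>P)"
    proof (rule Bochner_Integration.integral_cong[OF refl])
      fix \<omega> assume \<omega>: "\<omega> \<in> space P"
      then have "{e \<in> \<omega>. \<one>\<^bsub>G\<^esub> \<in> e} = {e \<in> E1. e \<in> \<omega>}"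
        by (auto simp: space_P E1_def)
      then show "real (vertex_degree \<omega> \<one>\<^bsub>G\<^esub>) = (\<Sum>e\<in>E1. indicator {\<omega> \<in> Pow E. e \<in> \<omega>} \<omega>)"
        using \<omega> fin unfolding vertex_degree_def
        by (simp add: space_P indicator_def sum.If_cases Int_def)
    qed
    also have "\<dots> = (\<Sum>e\<in>E1. measure P {\<omega> \<in> Pow E. e \<in> \<omega>})"
      using open_sets by (subst Bochner_Integration.integral_sum)
        (auto simp del: Pow_iff intro!: sum.cong simp: P.emeasure_eq_measure)
    also have "\<dots> \<ge> (\<Sum>e\<in>E1. \<alpha>)"
      by (intro sum_mono open_prob)
    also have "(\<Sum>e\<in>E1. \<alpha>) = \<alpha> * real (vertex_degree (cayley_edges G S) \<one>\<^bsub>G\<^esub>)"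
      by (simp add: vertex_degree_def E1_def E_def)
    finally show ?thesis .
  qed

  \<comment> \<open>Bounds on the two-point function\<close>
  have "exp (- c * D * real (word_length G S g)) \<le> two_point P \<one>\<^bsub>G\<^esub> g \<and>
      two_point P \<one>\<^bsub>G\<^esub> g \<le> exp (- c * wall_dist M x0 (\<phi> g x0))" if g: "g \<in> carrier G" for g
  proof
    let ?C = "{\<omega> \<in> Pow E. g \<in> cluster \<omega> \<one>\<^bsub>G\<^esub>}"
    have C: "?C \<in> sets (configurations E)"
      by (rule cluster_event_in_sets[OF E_countable])
    have two_point: "two_point P \<one>\<^bsub>G\<^esub> g = measure P ?C"
      unfolding two_point_def space_P by simp
    \<comment> \<open>\<open>F\<close> comes from a geodesic: the path has exactly
      \<open>word_length G S g\<close> steps.\<close>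
    obtain F where F: "finite F" "F \<subseteq> E" "(\<one>\<^bsub>G\<^esub>, g) \<in> (adjacency F)\<^sup>*"
      "measure M (\<Union>e\<in>F. edge_walls e) \<le> real (word_length G S g) * D"
      using path_walls_le[OF S word_length_path[OF S(2) g]] unfolding E_def D_def by blast
    have "exp (- c * D * real (word_length G S g)) \<le> exp (- c * measure M (\<Union>e\<in>F. edge_walls e))"
      using mult_left_mono[OF F(4), of c] c by (simp add: algebra_simps)
    also have "\<dots> = measure P {\<omega> \<in> Pow E. F \<subseteq> \<omega>}"
      using law F by simp
    also have "\<dots> \<le> measure P ?C"
    proof (rule P.finite_measure_mono)
      show "{\<omega> \<in> Pow E. F \<subseteq> \<omega>} \<subseteq> ?C"
        using F adjacency_rtrancl_mono unfolding cluster_def by blast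
    qed (use C sets_P in simp)
    finally show "exp (- c * D * real (word_length G S g)) \<le> two_point P \<one>\<^bsub>G\<^esub> g"
      unfolding two_point .

    have pair: "{\<one>\<^bsub>G\<^esub>, g} \<in> pairs" using g unfolding pairs_def by auto
    let ?\<F> = "{F. finite F \<and> F \<subseteq> E \<and> (\<one>\<^bsub>G\<^esub>, g) \<in> (adjacency F)\<^sup>*}"
    have "countable ?\<F>"
      using countable_Collect_finite_subset[OF E_countable]
      by (rule countable_subset[rotated]) auto
    \<comment> \<open>Every wall of the pair is a wall of some edge of \<open>F\<close>, so the pair
      is almost surely open when \<open>F\<close> is. Since there are countably many such
      \<open>F\<close>, the exceptional null sets combine into one.\<close>
    moreover have "AE \<omega> in P'. F \<subseteq> \<omega> \<longrightarrow> {\<one>\<^bsub>G\<^esub>, g} \<in> \<omega>" if "F \<in> ?\<F>" for F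
      using that E_pairs edge_walls_path[of "\<one>\<^bsub>G\<^esub>" g F]
      by (intro avoidance_law_AE_open[OF P' _ _ pair]) auto
    ultimately have "AE \<omega> in P'. \<forall>F\<in>?\<F>. F \<subseteq> \<omega> \<longrightarrow> {\<one>\<^bsub>G\<^esub>, g} \<in> \<omega>"
      by (subst AE_ball_countable) auto
    then have AE: "AE \<omega> in P'. g \<in> cluster (\<omega> \<inter> E) \<one>\<^bsub>G\<^esub> \<longrightarrow> {\<one>\<^bsub>G\<^esub>, g} \<in> \<omega>"
    proof (rule AE_mp, intro AE_I2 impI)
      fix \<omega> assume *: "\<forall>F\<in>?\<F>. F \<subseteq> \<omega> \<longrightarrow> {\<one>\<^bsub>G\<^esub>, g} \<in> \<omega>" "g \<in> cluster (\<omega> \<inter> E) \<one>\<^bsub>G\<^esub>"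
      from *(2) obtain F where "F \<in> ?\<F>" "F \<subseteq> \<omega> \<inter> E"
        using cluster_event[of "\<omega> \<inter> E" E g "\<one>\<^bsub>G\<^esub>"] by blast
      with *(1) show "{\<one>\<^bsub>G\<^esub>, g} \<in> \<omega>" by blast
    qed
    \<comment> \<open>The comparison takes place under \<open>P'\<close>, where the pair has a state
      of its own even if it is not an edge, and where its probability of being open is known
      exactly.\<close>
    have "measure P ?C = measure P' ((\<lambda>\<omega>. \<omega> \<inter> E) -` ?C \<inter> space P')"
      unfolding P_def by (rule measure_distr[OF restrict C])
    also have "\<dots> \<le> measure P' {\<omega> \<in> Pow pairs. {{\<one>\<^bsub>G\<^esub>, g}} \<subseteq> \<omega>}"
    proof (rule P'.finite_measure_mono_AE)
      show "AE \<omega> in P'. \<omega> \<in> (\<lambda>\<omega>. \<omega> \<inter> E) -` ?C \<inter> space P' \<longrightarrow> \<omega> \<in> {\<omega> \<in> Pow pairs. {{\<one>\<^bsub>G\<^esub>, g}} \<subseteq> \<omega>}"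
        using AE by eventually_elim (auto simp: avoidance_law_space[OF P'])
      show "{\<omega> \<in> Pow pairs. {{\<one>\<^bsub>G\<^esub>, g}} \<subseteq> \<omega>} \<in> P'.events"
        unfolding avoidance_lawD(2)[OF P'] using pair by (intro edges_open_in_sets) auto
    qed
    also have "\<dots> = exp (- c * measure M (edge_walls {\<one>\<^bsub>G\<^esub>, g}))"
      using avoidance_lawD(3)[OF P', of "{{\<one>\<^bsub>G\<^esub>, g}}"] pair by simp
    also have "measure M (edge_walls {\<one>\<^bsub>G\<^esub>, g}) = wall_dist M x0 (\<phi> g x0)"
      unfolding edge_walls_pair wall_dist_def using id_eq_one x0 by (metis restrict_apply')
    finally show "two_point P \<one>\<^bsub>G\<^esub> g \<le> exp (- c * wall_dist M x0 (\<phi> g x0))"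
      unfolding two_point .
  qed
  with invariant degree show ?thesis
    unfolding c_def D_def by blast
qed

end
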